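(* For the infinite triangular grid $TRI$, the minimum density of a RED:LD set is $\textrm{RED:LD}\%(TRI) = \frac{1}{3}$.
   Context: $TRI$ is the infinite 6-regular triangular grid graph. $N(v)$ denotes the open neighborhood of $v$. A set $S \subseteq V(G)$ is a locating-dominating (LD) set if for all $u,v \in V(G)-S$: $N(v)\cap S \neq \varnothing$, and if $u \ne v$ then $N(v) \cap S \neq N(u) \cap S$. A RED:LD set is an LD set $S$ such that $S-\{v\}$ is an LD set for every $v \in S$. For an infinite graph, the density of $S$ is the ratio of the number of detectors to the number of vertices (in the usual limiting sense), and $\textrm{RED:LD}\%(G)$ is the minimum density of a RED:LD set. *)

theory Defs
  imports "HOL-Analysis.Analysis"
begin

text \<open>A graph is given by its symmetric, irreflexive edge relation; its vertex set is the whole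
  type.\<close>

definition nbhd :: "('v \<times> 'v) set \<Rightarrow> 'v \<Rightarrow> 'v set" where
  "nbhd E v = {u. (v, u) \<in> E}"

definition LD_set :: "('v \<times> 'v) set \<Rightarrow> 'v set \<Rightarrow> bool" where
  "LD_set E S \<longleftrightarrow> (\<forall>u v. u \<notin> S \<and> v \<notin> S \<longrightarrow>
     nbhd E v \<inter> S \<noteq> {} \<and> (u \<noteq> v \<longrightarrow> nbhd E v \<inter> S \<noteq> nbhd E u \<inter> S))"

definition RED_LD_set :: "('v \<times> 'v) set \<Rightarrow> 'v set \<Rightarrow> bool" where
  "RED_LD_set E S \<longleftrightarrow> LD_set E S \<and> (\<forall>v\<in>S. LD_set E (S - {v}))"

text \<open>The vertices at graph distance at most \<open>r\<close> from \<open>v\<close>.\<close>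

definition graph_ball :: "('v \<times> 'v) set \<Rightarrow> 'v \<Rightarrow> nat \<Rightarrow> 'v set" where
  "graph_ball E v r = {u. \<exists>k\<le>r. (v, u) \<in> E ^^ k}"

text \<open>Density in the convention usual for locally finite infinite graphs: the upper limit of the
  proportion of detectors in growing balls. The limit itself need not exist.\<close>

definition density_at :: "('v \<times> 'v) set \<Rightarrow> 'v \<Rightarrow> 'v set \<Rightarrow> ereal" where
  "density_at E v S =
     limsup (\<lambda>r. ereal (real (card (graph_ball E v r \<inter> S)) / real (card (graph_ball E v r))))"

text \<open>The density does not depend on the centre of the balls in the graphs of interest, so no centre
  is singled out: an optimal set attains the minimum around every vertex, and no set goes
  below it around any vertex.\<close>

definition is_RED_LD_percent :: "('v \<times> 'v) set \<Rightarrow> ereal \<Rightarrow> bool" where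
  "is_RED_LD_percent E d \<longleftrightarrow>
     (\<exists>S. RED_LD_set E S \<and> (\<forall>v. density_at E v S = d)) \<and>
     (\<forall>S v. RED_LD_set E S \<longrightarrow> d \<le> density_at E v S)"

text \<open>The pair \<open>(x, y)\<close> stands for the point \<open>x + y \<omega>\<close> of the triangular lattice, where
  \<open>\<omega> = exp (\<i> pi / 3)\<close>; the six nearest lattice points differ from it by
  \<open>1, -1, \<omega>, -\<omega>, 1 - \<omega>, \<omega> - 1\<close>.\<close>

definition TRI :: "((int \<times> int) \<times> (int \<times> int)) set" where
  "TRI = {((x, y), (x', y')). (x' - x, y' - y) \<in> {(1, 0), (-1, 0), (0, 1), (0, -1), (1, -1), (-1, 1)}}"

end

theory Submission
  imports Defs
begin

text \<open>
  Let \<open>S\<close> be a RED:LD set and let a detector receive \<open>1 / |N[w] \<inter> S|\<close> from each vertex \<open>w\<close> of its closed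
  neighbourhood; the total it receives is its share. Every closed neighbourhood contains at least two
  detectors, so a vertex contributes at most \<open>1/2\<close>, and a share is at most \<open>4/2 + 3/3 = 3\<close> as soon as
  three contributing vertices see three detectors. This happens at every detector except the two ends
  of an isolated edge of \<open>S\<close>, and there the two shares add up to at most 6: on either side of the edge,
  the common neighbour of its ends sees four detectors, or it sees three and then so does one of the
  outer neighbours on that side. Hence shares average at most 3 and the density is at least \<open>1/3\<close>.

  Equality holds for the points \<open>(x, y)\<close> with \<open>x + 2 y \<equiv> 0\<close> or \<open>2\<close> modulo 6. Six consecutive
  horizontal translates of this set cover every vertex exactly twice, so its density is at most \<open>1/3\<close>.
\<close>

section \<open>Redundant locating-dominating sets in general graphs\<close>

definition detectors :: "('v \<times> 'v) set \<Rightarrow> 'v set \<Rightarrow> 'v \<Rightarrow> 'v set" where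
  "detectors E S v = insert v (nbhd E v) \<inter> S"

definition share :: "('v \<times> 'v) set \<Rightarrow> 'v set \<Rightarrow> 'v \<Rightarrow> real" where
  "share E S v = (\<Sum>w\<in>insert v (nbhd E v). 1 / real (card (detectors E S w)))"

text \<open>At a \<open>w\<close> outside \<open>S\<close>, deletion changes nothing, so a check
  that is uniform in \<open>w\<close> also covers \<open>S\<close> itself.\<close>

lemma RED_LD_setI:
  assumes "\<And>w. LD_set E (S - {w})" "w \<notin> S"
  shows "RED_LD_set E S"
  using assms(1)[of w] assms by (simp add: RED_LD_set_def)

lemma RED_LD_set_nbhd_nonempty:
  assumes "RED_LD_set E S" "v \<in> S"
  shows "nbhd E v \<inter> (S - {v}) \<noteq> {}"
proof -
  have "LD_set E (S - {v})" using assms by (simp add: RED_LD_set_def)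
  then show ?thesis unfolding LD_set_def by blast
qed

lemma RED_LD_set_separates:
  assumes "RED_LD_set E S" "w \<in> S" "u \<notin> S - {w}" "v \<notin> S - {w}" "u \<noteq> v"
  shows "nbhd E v \<inter> (S - {w}) \<noteq> nbhd E u \<inter> (S - {w})"
proof -
  have "LD_set E (S - {w})" using assms(1,2) by (simp add: RED_LD_set_def)
  then show ?thesis using assms(3-5) unfolding LD_set_def by simp
qed

text \<open>A detector sees itself and, once deleted, still needs a detector among its neighbours. A
  non-detector sees some \<open>a\<close> and needs another detector once \<open>a\<close> is
  deleted.\<close>

lemma card_detectors_ge_2:
  assumes S: "RED_LD_set E S" and fin: "finite (nbhd E v)"
  shows "2 \<le> card (detectors E S v)"
proof -
  have "\<exists>a b. a \<noteq> b \<and> {a, b} \<subseteq> detectors E S v"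
  proof (cases "v \<in> S")
    case True
    then obtain a where "a \<in> nbhd E v \<inter> (S - {v})"
      using RED_LD_set_nbhd_nonempty[OF S] by blast
    then show ?thesis using True
      by (intro exI[of _ v] exI[of _ a]) (auto simp: detectors_def)
  next
    case False
    then obtain a where a: "a \<in> nbhd E v \<inter> S"
      using S unfolding RED_LD_set_def LD_set_def by blast
    moreover obtain b where "b \<in> nbhd E v \<inter> (S - {a})"
      using S a False unfolding RED_LD_set_def LD_set_def by blast
    ultimately show ?thesis
      by (intro exI[of _ a] exI[of _ b]) (auto simp: detectors_def)
  qed
  then obtain a b where ab: "a \<noteq> b" "{a, b} \<subseteq> detectors E S v" by blast
  have "card {a, b} \<le> card (detectors E S v)"
    using fin ab by (intro card_mono) (auto simp: detectors_def)
  then show ?thesis using ab by simp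
qed

lemma card_ge_3I:
  assumes "finite A" "a \<in> A" "b \<in> A" "c \<in> A" "a \<noteq> b" "a \<noteq> c" "b \<noteq> c"
  shows "3 \<le> card A"
proof -
  have "card {a, b, c} \<le> card A" using assms by (intro card_mono) auto
  then show ?thesis using assms by simp
qed

lemma inverse_card_le: "0 < m \<Longrightarrow> m \<le> card A \<Longrightarrow> 1 / real (card A) \<le> 1 / real m"
  by (simp add: frac_le)

text \<open>Delete \<open>v\<close>: then \<open>v\<close> and \<open>u\<close> are both
  non-detectors and \<open>v\<close> sees only \<open>a\<close>. As \<open>u\<close> also sees
  \<open>a\<close>, it can differ from \<open>v\<close> only through a further detector, besides
  \<open>a\<close> and \<open>v\<close>.\<close>

lemma leaf_common_nbhd_card_ge_3:
  assumes S: "RED_LD_set E S" and fin: "finite (nbhd E u)" and sym: "sym E"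
    and v: "v \<in> S" "nbhd E v \<inter> S = {a}" "a \<noteq> v"
    and u: "u \<in> nbhd E v" "u \<in> nbhd E a" "u \<noteq> a" "u \<noteq> v"
  shows "3 \<le> card (detectors E S u)"
proof -
  have uS: "u \<notin> S" using v u by blast
  have adj: "v \<in> nbhd E u" "a \<in> nbhd E u"
    using sym u by (auto simp: nbhd_def dest: symD)
  have "nbhd E v \<inter> (S - {v}) \<noteq> nbhd E u \<inter> (S - {v})"
    using RED_LD_set_separates[OF S v(1), of u v] uS u by blast
  moreover have "nbhd E v \<inter> (S - {v}) = {a}" using v by blast
  ultimately have "nbhd E u \<inter> (S - {v}) \<noteq> {a}" by simp
  moreover have "a \<in> nbhd E u \<inter> (S - {v})" using adj v by blast
  ultimately obtain c where "c \<in> nbhd E u \<inter> (S - {v})" "c \<noteq> a"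
    by (metis insertI1 insert_absorb singleton_iff subsetI subset_singletonD empty_iff)
  then show ?thesis
    using fin adj v by (intro card_ge_3I[of _ v a c]) (auto simp: detectors_def)
qed

text \<open>Delete \<open>c\<close>: then \<open>m\<close> sees exactly \<open>a\<close> and
  \<open>b\<close>, which \<open>p\<close> sees too, so only a further detector can tell
  \<open>p\<close> from \<open>m\<close>.\<close>

lemma shared_pair_card_ge_3:
  assumes S: "RED_LD_set E S" and fin: "finite (nbhd E p)"
    and m: "m \<notin> S" "nbhd E m \<inter> S = {a, b, c}" "c \<noteq> a" "c \<noteq> b"
    and p: "p \<notin> S" "p \<noteq> m" "a \<in> nbhd E p" "b \<in> nbhd E p" "a \<noteq> b"
  shows "3 \<le> card (detectors E S p)"
proof -
  have cS: "a \<in> S" "b \<in> S" "c \<in> S" using m by blast+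
  have "nbhd E m \<inter> (S - {c}) \<noteq> nbhd E p \<inter> (S - {c})"
    using RED_LD_set_separates[OF S cS(3), of p m] m p by blast
  moreover have "nbhd E m \<inter> (S - {c}) = {a, b}" using m by blast
  moreover have "{a, b} \<subseteq> nbhd E p \<inter> (S - {c})" using p cS m by blast
  ultimately obtain d where "d \<in> nbhd E p \<inter> (S - {c})" "d \<noteq> a" "d \<noteq> b" by blast
  then show ?thesis
    using fin p cS by (intro card_ge_3I[of _ a b d]) (auto simp: detectors_def)
qed

text \<open>An involution: it swaps the ends of an isolated edge of \<open>S\<close> and fixes
  everything else, so one bound on \<open>share v + share (partner v)\<close> covers both kinds of
  detector.\<close>

definition partner :: "('v \<times> 'v) set \<Rightarrow> 'v set \<Rightarrow> 'v \<Rightarrow> 'v" where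
  "partner E S v =
     (if \<exists>a. nbhd E v \<inter> S = {a} \<and> nbhd E a \<inter> S = {v}
      then the_elem (nbhd E v \<inter> S) else v)"

lemma partner_eq:
  assumes "nbhd E v \<inter> S = {a}" "nbhd E a \<inter> S = {v}"
  shows "partner E S v = a"
  using assms by (auto simp: partner_def)

lemma partner_cases:
  obtains "partner E S v = v"
  | a where "partner E S v = a" "nbhd E v \<inter> S = {a}" "nbhd E a \<inter> S = {v}"
proof (cases "\<exists>a. nbhd E v \<inter> S = {a} \<and> nbhd E a \<inter> S = {v}")
  case True
  then obtain a where a: "nbhd E v \<inter> S = {a}" "nbhd E a \<inter> S = {v}" by (elim exE conjE)
  show ?thesis by (rule that(2)[OF partner_eq[OF a] a])
next
  case False
  then have "partner E S v = v" unfolding partner_def by (rule if_not_P)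
  then show ?thesis by (rule that(1))
qed

lemma partner_partner: "partner E S (partner E S v) = v"
  by (cases rule: partner_cases[of E S v]) (simp_all add: partner_eq)

section \<open>Balls and the averaging of shares\<close>

lemma graph_ball_Suc_nbhd:
  assumes "w \<in> graph_ball E c r" "u \<in> nbhd E w"
  shows "u \<in> graph_ball E c (Suc r)"
proof -
  obtain k where "k \<le> r" "(c, w) \<in> E ^^ k" using assms by (auto simp: graph_ball_def)
  then show ?thesis using assms(2) unfolding graph_ball_def nbhd_def
    by (auto intro!: exI[of _ "Suc k"])
qed

lemma graph_ball_mono: "r \<le> s \<Longrightarrow> graph_ball E c r \<subseteq> graph_ball E c s"
  unfolding graph_ball_def using order_trans by blast

lemma graph_ball_0: "graph_ball E c 0 = {c}"
  by (auto simp: graph_ball_def)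

lemma graph_ball_Suc:
  "graph_ball E c (Suc r) = graph_ball E c r \<union> (\<Union>w\<in>graph_ball E c r. nbhd E w)"
proof (intro equalityI subsetI)
  fix u assume "u \<in> graph_ball E c (Suc r)"
  then obtain k where k: "k \<le> Suc r" "(c, u) \<in> E ^^ k" by (auto simp: graph_ball_def)
  show "u \<in> graph_ball E c r \<union> (\<Union>w\<in>graph_ball E c r. nbhd E w)"
  proof (cases "k \<le> r")
    case True
    then show ?thesis using k by (auto simp: graph_ball_def)
  next
    case False
    then have "k = Suc r" using k by simp
    then obtain w where "(c, w) \<in> E ^^ r" "(w, u) \<in> E" using k by auto
    then show ?thesis by (auto simp: graph_ball_def nbhd_def)
  qed
next
  fix u assume "u \<in> graph_ball E c r \<union> (\<Union>w\<in>graph_ball E c r. nbhd E w)"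
  then show "u \<in> graph_ball E c (Suc r)"
    using graph_ball_mono[of r "Suc r" E c] graph_ball_Suc_nbhd[of _ E c r u] by auto
qed

text \<open>Each vertex of the ball hands out a total of 1 to the detectors it sees, all within
  radius \<open>Suc r\<close>. Collecting by recipient gives at most the full shares, which may also
  include contributions from outside the ball.\<close>

lemma card_ball_le_sum_share:
  assumes fin: "finite (graph_ball E c (Suc r))" and fin': "\<And>w. finite (nbhd E w)"
    and sym: "sym E" and dom: "\<And>w. 0 < card (detectors E S w)"
  shows "real (card (graph_ball E c r)) \<le> sum (share E S) (graph_ball E c (Suc r) \<inter> S)"
proof -
  let ?B = "graph_ball E c r" and ?B' = "graph_ball E c (Suc r) \<inter> S"
  let ?f = "\<lambda>w. 1 / real (card (detectors E S w))"
  have finB: "finite ?B" using fin graph_ball_mono[of r "Suc r" E c] by (auto intro: finite_subset)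
  \<comment> \<open>The inner sum is \<open>n * (1 / n) = 1\<close>; \<open>dom\<close> excludes
    \<open>n = 0\<close>, where it would be 0.\<close>
  have "real (card ?B) = (\<Sum>w\<in>?B. \<Sum>v\<in>detectors E S w. ?f w)"
    using dom by (simp add: less_imp_neq[symmetric])
  also have "\<dots> = (\<Sum>w\<in>?B. \<Sum>v | v \<in> ?B' \<and> v \<in> insert w (nbhd E w). ?f w)"
  proof (intro sum.cong refl)
    fix w assume "w \<in> ?B"
    then show "detectors E S w = {v. v \<in> ?B' \<and> v \<in> insert w (nbhd E w)}"
      using graph_ball_Suc_nbhd[of w E c r] graph_ball_mono[of r "Suc r" E c]
      by (auto simp: detectors_def)
  qed
  also have "\<dots> = (\<Sum>v\<in>?B'. \<Sum>w | w \<in> ?B \<and> v \<in> insert w (nbhd E w). ?f w)"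
    using finB fin by (intro sum.swap_restrict) auto
  also have "\<dots> \<le> sum (share E S) ?B'"
    unfolding share_def
  proof (intro sum_mono sum_mono2)
    fix v
    show "finite (insert v (nbhd E v))" using fin' by simp
    show "{w. w \<in> ?B \<and> v \<in> insert w (nbhd E w)} \<subseteq> insert v (nbhd E v)"
      using sym by (auto simp: nbhd_def dest: symD)
  qed auto
  finally show ?thesis .
qed

text \<open>The radius grows by 2: one step to reach every detector paid by the ball, and one more
  to close this set under \<open>partner\<close>. On the closed set \<open>T\<close> the involution
  permutes the summands, so the pair bound \<open>2 * d\<close> averages to \<open>d\<close> per
  detector.\<close>

lemma card_ball_le_card_detectors:
  assumes fin: "finite (graph_ball E c (Suc (Suc r)))" and fin': "\<And>w. finite (nbhd E w)"
    and sym: "sym E" and dom: "\<And>w. 0 < card (detectors E S w)"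
    and share: "\<And>v. v \<in> S \<Longrightarrow> share E S v + share E S (partner E S v) \<le> 2 * d"
    and d: "0 \<le> d"
  shows "real (card (graph_ball E c r)) \<le> d * card (graph_ball E c (Suc (Suc r)) \<inter> S)"
proof -
  let ?B' = "graph_ball E c (Suc r) \<inter> S" and ?B'' = "graph_ball E c (Suc (Suc r)) \<inter> S"
  define T where "T = ?B' \<union> partner E S ` ?B'"
  have TB: "T \<subseteq> ?B''"
  proof
    fix v assume "v \<in> T"
    then consider "v \<in> ?B'" | u where "u \<in> ?B'" "v = partner E S u" by (auto simp: T_def)
    then show "v \<in> ?B''"
    proof cases
      case 1 then show ?thesis using graph_ball_mono[of "Suc r" "Suc (Suc r)" E c] by auto
    next
      case 2
      show ?thesis
      proof (cases rule: partner_cases[of E S u])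
        case 1
        then show ?thesis using 2 graph_ball_mono[of "Suc r" "Suc (Suc r)" E c] by auto
      next
        case (2 a)
        then show ?thesis using \<open>u \<in> ?B'\<close> \<open>v = partner E S u\<close> graph_ball_Suc_nbhd[of u E c "Suc r" a]
          by blast
      qed
    qed
  qed
  have finT: "finite T" using TB fin by (auto intro: finite_subset)
  have fin1: "finite (graph_ball E c (Suc r))"
    using fin graph_ball_mono[of "Suc r" "Suc (Suc r)" E c] by (auto intro: finite_subset)
  have "bij_betw (partner E S) T T"
    by (rule bij_betw_byWitness[where f' = "partner E S"]) (auto simp: T_def partner_partner)
  then have "(\<Sum>v\<in>T. share E S (partner E S v)) = sum (share E S) T"
    by (rule sum.reindex_bij_betw)
  then have "2 * sum (share E S) T = (\<Sum>v\<in>T. share E S v + share E S (partner E S v))"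
    by (simp add: sum.distrib)
  also have "\<dots> \<le> (\<Sum>v\<in>T. 2 * d)"
    using TB by (intro sum_mono share) auto
  finally have "sum (share E S) T \<le> d * card T" by (simp add: mult.commute)
  \<comment> \<open>Adding the missing partners cannot lower the sum, as shares are
    nonnegative.\<close>
  moreover have "sum (share E S) ?B' \<le> sum (share E S) T"
    using finT by (intro sum_mono2) (auto simp: T_def share_def intro!: sum_nonneg)
  moreover have "real (card (graph_ball E c r)) \<le> sum (share E S) ?B'"
    by (rule card_ball_le_sum_share[OF fin1 fin' sym dom])
  moreover have "d * card T \<le> d * card ?B''"
    using TB fin d by (intro mult_left_mono) (auto intro: card_mono)
  ultimately show ?thesis by linarith
qed

section \<open>The triangular grid\<close>

definition dirs :: "(int \<times> int) set" where
  "dirs = {(1, 0), (-1, 0), (0, 1), (0, -1), (1, -1), (-1, 1)}"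

text \<open>Multiplication by \<open>\<omega>\<close>, which satisfies \<open>\<omega>\<^sup>2 = \<omega> - 1\<close>.\<close>

definition rot :: "int \<times> int \<Rightarrow> int \<times> int" where
  "rot d = (- snd d, fst d + snd d)"

lemma sym_TRI: "sym TRI"
  by (auto simp: sym_def TRI_def)

lemma nbhd_TRI: "nbhd TRI v = (+) v ` dirs"
proof -
  have "u \<in> nbhd TRI v \<longleftrightarrow> u - v \<in> dirs" for u
    by (cases u; cases v) (auto simp: nbhd_def TRI_def dirs_def)
  then show ?thesis by (force simp: image_iff algebra_simps)
qed

lemma nbhd_TRI_dirsE:
  assumes "a \<in> nbhd TRI v"
  obtains d where "d \<in> dirs" "a = v + d"
  using assms by (auto simp: nbhd_TRI)

lemma finite_nbhd_TRI: "finite (nbhd TRI v)"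
  by (simp add: nbhd_TRI dirs_def)

lemma dirs_cases:
  assumes "d \<in> dirs"
  obtains "d = (1, 0)" | "d = (-1, 0)" | "d = (0, 1)" | "d = (0, -1)" | "d = (1, -1)" | "d = (-1, 1)"
  using assms unfolding dirs_def by blast

text \<open>These are the multiples of \<open>d\<close> by the six powers of \<omega>, in cyclic
  order. Writing neighbourhoods relative to an arbitrary \<open>d\<close> replaces later case
  distinctions over the six directions.\<close>

lemma dirs_rot:
  assumes "d \<in> dirs"
  shows "dirs = {d, rot d, rot d - d, - d, - rot d, d - rot d}"
  using assms by (cases rule: dirs_cases) (simp_all add: dirs_def rot_def insert_commute)

lemma nbhd_TRI_rot:
  assumes "d \<in> dirs"
  shows "nbhd TRI v = {v + d, v + rot d, v + rot d - d, v - d, v - rot d, v + d - rot d}"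
  unfolding nbhd_TRI dirs_rot[OF assms] by (simp add: algebra_simps)

lemma rot_distinct:
  assumes "d \<in> dirs"
  shows "distinct [0, d, rot d, rot d - d, - d, - rot d, d - rot d]"
  using assms by (cases rule: dirs_cases) (simp_all add: rot_def, simp_all add: prod_eq_iff)

lemma rot_uminus: "rot (- d) = - rot d"
  by (simp add: rot_def)

lemma uminus_dirs: "d \<in> dirs \<Longrightarrow> - d \<in> dirs"
  by (auto simp: dirs_def)

lemma insert_nbhd_TRI_rot:
  assumes "d \<in> dirs"
  shows "insert v (nbhd TRI v) =
    set (map ((+) v) [0, d, rot d, rot d - d, - d, - rot d, d - rot d])"
  unfolding nbhd_TRI_rot[OF assms] by (simp add: algebra_simps)

lemma sum_insert_nbhd_TRI_rot:
  assumes "d \<in> dirs"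
  shows "sum f (insert v (nbhd TRI v)) = f v + f (v + d) + f (v + rot d) + f (v + rot d - d)
    + f (v - d) + f (v - rot d) + f (v + d - rot d)"
proof -
  have "distinct (map ((+) v) [0, d, rot d, rot d - d, - d, - rot d, d - rot d])"
    unfolding distinct_map using rot_distinct[OF assms] by simp
  from sum.distinct_set_conv_list[OF this, of f] show ?thesis
    unfolding insert_nbhd_TRI_rot[OF assms] by (simp add: algebra_simps)
qed

lemma card_insert_nbhd_TRI: "card (insert v (nbhd TRI v)) = 7"
proof -
  have "real (card (insert v (nbhd TRI v))) = (\<Sum>w\<in>insert v (nbhd TRI v). 1)" by simp
  also have "\<dots> = 7" by (subst sum_insert_nbhd_TRI_rot[of "(1, 0)"]) (auto simp: dirs_def)
  finally show ?thesis by simp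
qed

lemma card_leaf_sides:
  assumes "d \<in> dirs"
  shows "card {v + d, v + rot d, v + d - rot d} = 3"
proof -
  have "distinct [v + d, v + rot d, v + d - rot d]"
    using assms by (cases v; auto simp: dirs_def rot_def prod_eq_iff)
  from distinct_card[OF this] show ?thesis by simp
qed

lemma not_in_nbhd_TRI: "v \<notin> nbhd TRI v"
  by (auto simp: nbhd_TRI dirs_def prod_eq_iff)

section \<open>Bounds on shares in the triangular grid\<close>

context
  fixes S :: "(int \<times> int) set"
  assumes S: "RED_LD_set TRI S"
begin

lemma card_detectors_TRI_ge_2: "2 \<le> card (detectors TRI S w)"
  by (rule card_detectors_ge_2[OF S finite_nbhd_TRI])

lemma share_le_3:
  assumes T: "T \<subseteq> insert v (nbhd TRI v)" "card T = 3"
    and ge3: "\<And>w. w \<in> T \<Longrightarrow> 3 \<le> card (detectors TRI S w)"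
  shows "share TRI S v \<le> 3"
proof -
  let ?N = "insert v (nbhd TRI v)" and ?f = "\<lambda>w. 1 / real (card (detectors TRI S w))"
  have "share TRI S v = sum ?f T + sum ?f (?N - T)"
    unfolding share_def using finite_nbhd_TRI T
    by (metis (no_types, lifting) add.commute finite_insert sum.subset_diff)
  also have "\<dots> \<le> real (card T) * (1 / 3) + real (card (?N - T)) * (1 / 2)"
    using inverse_card_le[OF _ ge3] inverse_card_le[OF _ card_detectors_TRI_ge_2]
    by (intro add_mono sum_bounded_above) auto
  also have "card (?N - T) = 4"
    using T card_insert_nbhd_TRI[of v] by (subst card_Diff_subset) (auto intro: card_ge_0_finite)
  finally show ?thesis using T by simp
qed

text \<open>The two vertices are the common neighbours of the leaf \<open>v\<close> and its only
  detector neighbour \<open>v + d\<close>.\<close>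

lemma leaf_sides_ge_3:
  assumes d: "d \<in> dirs" and v: "v \<in> S" "nbhd TRI v \<inter> S = {v + d}"
  shows "3 \<le> card (detectors TRI S (v + rot d))" "3 \<le> card (detectors TRI S (v + d - rot d))"
proof -
  have dist: "d \<noteq> 0" "rot d \<noteq> 0" "rot d \<noteq> d" using rot_distinct[OF d] by auto
  have "v + rot d \<in> nbhd TRI v" "v + d - rot d \<in> nbhd TRI v"
    by (simp_all add: nbhd_TRI_rot[OF d])
  moreover have "v + rot d \<in> nbhd TRI (v + d)" "v + d - rot d \<in> nbhd TRI (v + d)"
    by (simp_all add: nbhd_TRI_rot[OF d])
  ultimately show "3 \<le> card (detectors TRI S (v + rot d))"
    "3 \<le> card (detectors TRI S (v + d - rot d))"
    using dist by (auto intro!: leaf_common_nbhd_card_ge_3[OF S finite_nbhd_TRI sym_TRI v]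
        simp: algebra_simps)
qed

text \<open>The common neighbour on this side enters both shares, hence the factor 2; each outer
  neighbour enters one. If the common neighbour sees four detectors the bound is 2/4 + 1/2 + 1/2; if
  it sees three, it is 2/3 + 1/3 + 1/2.\<close>

lemma isolated_edge_side:
  assumes d: "d \<in> dirs" and v: "nbhd TRI v \<inter> S = {v + d}" "nbhd TRI (v + d) \<inter> S = {v}"
  defines "k \<equiv> \<lambda>w. 1 / real (card (detectors TRI S w))"
  shows "2 * k (v + rot d) + k (v + rot d - d) + k (v + d + rot d) \<le> 3 / 2"
proof -
  \<comment> \<open>\<open>X\<close> and \<open>Y\<close> are the neighbours of \<open>u\<close>
    adjacent to neither end of the edge; the other four are the two ends and the non-detectors
    \<open>u - d\<close>, \<open>u + d\<close>.\<close>
  define u X Y where "u = v + rot d" and "X = u + rot d - d" and "Y = u + rot d"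
  have dist: "distinct [0, d, rot d, rot d - d, - d, - rot d, d - rot d]"
    by (rule rot_distinct[OF d])
  have vS: "v \<in> S" "v + d \<in> S" using v by blast+
  have N: "nbhd TRI u = {u + d, Y, X, u - d, v, v + d}"
    unfolding nbhd_TRI_rot[OF d, of u] by (simp add: u_def X_def Y_def algebra_simps)
  have "u \<in> nbhd TRI v" "u - d \<in> nbhd TRI v" "u + d \<in> nbhd TRI (v + d)"
    by (simp_all add: nbhd_TRI_rot[OF d] u_def algebra_simps)
  moreover have "u \<noteq> v + d" "u - d \<noteq> v + d" "u + d \<noteq> v"
    using d by (cases v; auto simp: u_def dirs_def rot_def)+
  moreover have "x \<notin> S" if "x \<in> nbhd TRI v" "x \<noteq> v + d" for x using v(1) that by blast
  moreover have "x \<notin> S" if "x \<in> nbhd TRI (v + d)" "x \<noteq> v" for x using v(2) that by blast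
  ultimately have nS: "u \<notin> S" "u - d \<notin> S" "u + d \<notin> S" by simp_all
  have ne: "distinct [v, v + d, X, Y]"
  proof -
    have "distinct [0, d, rot d + rot d - d, rot d + rot d]"
      using d by (auto simp: dirs_def rot_def prod_eq_iff)
    then have "distinct (map ((+) v) [0, d, rot d + rot d - d, rot d + rot d])"
      by (subst distinct_map) simp
    moreover have "map ((+) v) [0, d, rot d + rot d - d, rot d + rot d] = [v, v + d, X, Y]"
      by (simp add: u_def X_def Y_def algebra_simps)
    ultimately show ?thesis by metis
  qed
  have det: "detectors TRI S u = {v, v + d} \<union> ({X, Y} \<inter> S)"
    using N nS vS by (auto simp: detectors_def)
  have u3: "3 \<le> card (detectors TRI S u)"
    unfolding u_def by (rule leaf_sides_ge_3[OF d vS(1) v(1)])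
  have k2: "k w \<le> 1 / 2" for w
    unfolding k_def using inverse_card_le[OF _ card_detectors_TRI_ge_2] by simp
  have k3: "k w \<le> 1 / 3" if "3 \<le> card (detectors TRI S w)" for w
    unfolding k_def using inverse_card_le[OF _ that] by simp
  have "2 * k u + k (u - d) + k (u + d) \<le> 3 / 2"
  proof -
    consider "X \<in> S" "Y \<in> S" | "X \<in> S" "Y \<notin> S" | "X \<notin> S" "Y \<in> S" | "X \<notin> S" "Y \<notin> S" by blast
    then show ?thesis
    proof cases
      case 1
      then have "card (detectors TRI S u) = 4" using det ne by auto
      then have "k u = 1 / 4" by (simp add: k_def)
      then show ?thesis using k2[of "u - d"] k2[of "u + d"] by simp
    next
      case 2
      \<comment> \<open>Deleting \<open>v + d\<close> leaves \<open>u\<close> with \<open>v\<close>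
        and \<open>X\<close>, both of which are neighbours of \<open>u - d\<close>. The next case is
        the mirror image.\<close>
      have "3 \<le> card (detectors TRI S (u - d))"
      proof (rule shared_pair_card_ge_3[OF S finite_nbhd_TRI nS(1), of v X "v + d"])
        show "nbhd TRI u \<inter> S = {v, X, v + d}" using N nS vS 2 by auto
        show "v \<in> nbhd TRI (u - d)" "X \<in> nbhd TRI (u - d)"
          by (simp_all add: nbhd_TRI_rot[OF d] u_def X_def algebra_simps)
      qed (use nS ne dist in auto)
      then show ?thesis using k3[of u] k3[of "u - d"] k2[of "u + d"] u3 by simp
    next
      case 3
      have "3 \<le> card (detectors TRI S (u + d))"
      proof (rule shared_pair_card_ge_3[OF S finite_nbhd_TRI nS(1), of "v + d" Y v])
        show "nbhd TRI u \<inter> S = {v + d, Y, v}" using N nS vS 3 by auto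
        show "v + d \<in> nbhd TRI (u + d)" "Y \<in> nbhd TRI (u + d)"
          by (simp_all add: nbhd_TRI_rot[OF d] u_def Y_def algebra_simps)
      qed (use nS ne dist in auto)
      then show ?thesis using k3[of u] k3[of "u + d"] k2[of "u - d"] u3 by simp
    next
      case 4
      \<comment> \<open>Here \<open>u\<close> would see only the two ends, contradicting
        \<open>u3\<close>.\<close>
      then show ?thesis using det u3 ne by auto
    qed
  qed
  then show ?thesis by (simp add: u_def algebra_simps)
qed

text \<open>Each of the two sides contributes at most 3/2. What remains is the two ends, counted
  twice each, and the vertices \<open>v - d\<close> and \<open>v + d + d\<close> on the line of the
  edge: six terms of at most 1/2.\<close>

lemma share_isolated_edge:
  assumes v: "nbhd TRI v \<inter> S = {a}" "nbhd TRI a \<inter> S = {v}"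
  shows "share TRI S v + share TRI S a \<le> 6"
proof -
  obtain d where d: "d \<in> dirs" "a = v + d" using v by (blast elim: nbhd_TRI_dirsE)
  let ?k = "\<lambda>w. 1 / real (card (detectors TRI S w))"
  have k2: "?k w \<le> 1 / 2" for w
    using inverse_card_le[OF _ card_detectors_TRI_ge_2] by simp
  have "2 * ?k (v + rot d) + ?k (v + rot d - d) + ?k (v + d + rot d) \<le> 3 / 2"
    using isolated_edge_side[OF d(1), of v] v d(2) by simp
  \<comment> \<open>The other side is obtained by a half turn, which exchanges the ends and negates
    \<open>d\<close>.\<close>
  moreover have "2 * ?k (a + rot (-d)) + ?k (a + rot (-d) - (-d)) + ?k (a + (-d) + rot (-d)) \<le> 3 / 2"
    using isolated_edge_side[OF uminus_dirs[OF d(1)], of a] v d(2) by simp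
  then have "2 * ?k (v + d - rot d) + ?k (v + d + d - rot d) + ?k (v - rot d) \<le> 3 / 2"
    by (simp add: rot_uminus d(2) algebra_simps)
  moreover have "share TRI S v = ?k v + ?k (v + d) + ?k (v + rot d) + ?k (v + rot d - d)
    + ?k (v - d) + ?k (v - rot d) + ?k (v + d - rot d)"
    unfolding share_def by (rule sum_insert_nbhd_TRI_rot[OF d(1)])
  moreover have "share TRI S a = ?k (v + d) + ?k (v + d + d) + ?k (v + d + rot d)
    + ?k (v + rot d) + ?k v + ?k (v + d - rot d) + ?k (v + d + d - rot d)"
    unfolding share_def d(2) sum_insert_nbhd_TRI_rot[OF d(1)] by (simp add: algebra_simps)
  ultimately show ?thesis
    using k2[of v] k2[of "v + d"] k2[of "v - d"] k2[of "v + d + d"] by linarith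
qed

lemma card_ge_3_of_not_leaf:
  assumes "v \<in> S" "a \<in> nbhd TRI v" "a \<in> S" "nbhd TRI v \<inter> S \<noteq> {a}"
  shows "3 \<le> card (detectors TRI S v)"
proof -
  obtain b where "b \<in> nbhd TRI v \<inter> S" "b \<noteq> a" using assms by blast
  then show ?thesis
    using assms finite_nbhd_TRI[of v] not_in_nbhd_TRI[of v]
    by (intro card_ge_3I[of _ v a b]) (auto simp: detectors_def)
qed

text \<open>Three vertices seeing three detectors are found as follows. If \<open>v\<close> is a
  leaf at \<open>a\<close>: \<open>a\<close>, which is no leaf, and the two common neighbours of
  \<open>v\<close> and \<open>a\<close>. If a leaf \<open>x\<close> hangs on a non-leaf
  \<open>v\<close>: \<open>v\<close> and the two common neighbours of \<open>x\<close> and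
  \<open>v\<close>. Otherwise: \<open>v\<close> and any two of its detector neighbours.\<close>

lemma share_le_3_of_not_isolated_edge:
  assumes v: "v \<in> S" and ni: "\<nexists>a. nbhd TRI v \<inter> S = {a} \<and> nbhd TRI a \<inter> S = {v}"
  shows "share TRI S v \<le> 3"
proof -
  have symN: "x \<in> nbhd TRI y \<longleftrightarrow> y \<in> nbhd TRI x" for x y
    using sym_TRI by (auto simp: nbhd_def dest: symD)
  obtain a where a: "a \<in> nbhd TRI v" "a \<in> S"
    using RED_LD_set_nbhd_nonempty[OF S v] by blast
  show ?thesis
  proof (cases "nbhd TRI v \<inter> S = {a}")
    case True
    obtain d where d: "d \<in> dirs" "a = v + d" using a by (blast elim: nbhd_TRI_dirsE)
    have "3 \<le> card (detectors TRI S a)"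
      using card_ge_3_of_not_leaf[of a v] a v True ni symN by blast
    then have "3 \<le> card (detectors TRI S w)" if "w \<in> {v + d, v + rot d, v + d - rot d}" for w
      using that leaf_sides_ge_3[OF d(1) v] True d(2) by blast
    moreover have "{v + d, v + rot d, v + d - rot d} \<subseteq> insert v (nbhd TRI v)"
      by (simp add: nbhd_TRI_rot[OF d(1)])
    moreover have "card {v + d, v + rot d, v + d - rot d} = 3"
      by (rule card_leaf_sides[OF d(1)])
    ultimately show ?thesis by (intro share_le_3)
  next
    case False
    have v3: "3 \<le> card (detectors TRI S v)"
      using card_ge_3_of_not_leaf[OF v a False] .
    obtain b where b: "b \<in> nbhd TRI v" "b \<in> S" "b \<noteq> a" using a False by blast
    show ?thesis
    proof (cases "\<exists>x\<in>nbhd TRI v \<inter> S. nbhd TRI x \<inter> S = {v}")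
      case True
      then obtain x where x: "x \<in> nbhd TRI v" "x \<in> S" "nbhd TRI x \<inter> S = {v}" by blast
      then obtain d where d: "d \<in> dirs" "v = x + d" using symN by (blast elim: nbhd_TRI_dirsE)
      have "3 \<le> card (detectors TRI S w)" if "w \<in> {v, x + rot d, x + d - rot d}" for w
        using that leaf_sides_ge_3[OF d(1) x(2)] x(3) d(2) v3 by blast
      moreover have "{v, x + rot d, x + d - rot d} \<subseteq> insert v (nbhd TRI v)"
        by (simp add: d(2) nbhd_TRI_rot[OF d(1)])
      moreover have "card {v, x + rot d, x + d - rot d} = 3"
        unfolding d(2) by (rule card_leaf_sides[OF d(1)])
      ultimately show ?thesis by (intro share_le_3)
    next
      case no_leaf: False
      have "3 \<le> card (detectors TRI S x)" if "x \<in> nbhd TRI v" "x \<in> S" for x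
        using card_ge_3_of_not_leaf[of x v] that v no_leaf symN by blast
      moreover have "card {v, a, b} = 3"
        using a b not_in_nbhd_TRI[of v] by (auto simp: card_insert_if)
      ultimately show ?thesis using a b v3 by (intro share_le_3[of "{v, a, b}"]) auto
    qed
  qed
qed

lemma share_add_share_partner_le_6:
  assumes "v \<in> S"
  shows "share TRI S v + share TRI S (partner TRI S v) \<le> 6"
proof (cases "\<exists>a. nbhd TRI v \<inter> S = {a} \<and> nbhd TRI a \<inter> S = {v}")
  case True
  then obtain a where a: "nbhd TRI v \<inter> S = {a}" "nbhd TRI a \<inter> S = {v}" by (elim exE conjE)
  show ?thesis using share_isolated_edge[OF a] partner_eq[OF a] by simp
next
  case False
  then have "partner TRI S v = v" by (auto simp: partner_def)
  then show ?thesis using share_le_3_of_not_isolated_edge[OF assms False] by simp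
qed

end

section \<open>Balls in the triangular grid\<close>

text \<open>The ball around the origin (see \<open>graph_ball_TRI\<close>): in these coordinates the
  distance is the maximum of |x|, |y| and |x + y|.\<close>

definition hexagon :: "nat \<Rightarrow> (int \<times> int) set" where
  "hexagon r = {(x, y). \<bar>x\<bar> \<le> int r \<and> \<bar>y\<bar> \<le> int r \<and> \<bar>x + y\<bar> \<le> int r}"

lemma hexagon_Suc: "hexagon (Suc r) = hexagon r \<union> (\<Union>e\<in>hexagon r. (+) e ` dirs)"
proof (intro equalityI subsetI)
  fix e assume "e \<in> hexagon (Suc r)"
  then obtain x y where e: "e = (x, y)"
    "\<bar>x\<bar> \<le> int (Suc r)" "\<bar>y\<bar> \<le> int (Suc r)" "\<bar>x + y\<bar> \<le> int (Suc r)"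
    by (auto simp: hexagon_def)
  have step: "e \<in> hexagon r \<union> (\<Union>e\<in>hexagon r. (+) e ` dirs)"
    if "(a, b) \<in> dirs" "(x - a, y - b) \<in> hexagon r" for a b
    by (rule UnI2, rule UN_I[OF that(2)], rule image_eqI[OF _ that(1)]) (simp add: e)
  \<comment> \<open>The signs select a step towards the origin. Away from the origin it lowers two
    of |x|, |y|, |x + y|, and the third is already at most \<open>r\<close>.\<close>
  consider "x > 0" "y \<ge> 0" | "x > 0" "y < 0" | "x < 0" "y > 0" | "x < 0" "y \<le> 0"
    | "x = 0" "y > 0" | "x = 0" "y < 0" | "x = 0" "y = 0"
    by (cases x "0::int" rule: linorder_cases; cases y "0::int" rule: linorder_cases) auto
  then show "e \<in> hexagon r \<union> (\<Union>e\<in>hexagon r. (+) e ` dirs)"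
  proof cases
    case 1
    show ?thesis
      by (rule step[of 1 0]) (use 1 e(2-4) in \<open>simp_all add: dirs_def hexagon_def abs_le_iff\<close>)
  next
    case 2
    show ?thesis
      by (rule step[of 1 "-1"]) (use 2 e(2-4) in \<open>simp_all add: dirs_def hexagon_def abs_le_iff\<close>)
  next
    case 3
    show ?thesis
      by (rule step[of "-1" 1]) (use 3 e(2-4) in \<open>simp_all add: dirs_def hexagon_def abs_le_iff\<close>)
  next
    case 4
    show ?thesis
      by (rule step[of "-1" 0]) (use 4 e(2-4) in \<open>simp_all add: dirs_def hexagon_def abs_le_iff\<close>)
  next
    case 5
    show ?thesis
      by (rule step[of 0 1]) (use 5 e(2-4) in \<open>simp_all add: dirs_def hexagon_def abs_le_iff\<close>)
  next
    case 6
    show ?thesis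
      by (rule step[of 0 "-1"]) (use 6 e(2-4) in \<open>simp_all add: dirs_def hexagon_def abs_le_iff\<close>)
  next
    case 7 then show ?thesis using e by (auto simp: hexagon_def)
  qed
next
  fix e assume "e \<in> hexagon r \<union> (\<Union>e\<in>hexagon r. (+) e ` dirs)"
  then show "e \<in> hexagon (Suc r)" by (auto simp: hexagon_def dirs_def)
qed

lemma graph_ball_TRI: "graph_ball TRI c r = (+) c ` hexagon r"
proof (induction r)
  case 0
  have "hexagon 0 = {0}" by (auto simp: hexagon_def prod_eq_iff)
  then show ?case by (simp add: graph_ball_0)
next
  case (Suc r)
  have "(\<Union>w\<in>(+) c ` hexagon r. (+) w ` dirs) = (+) c ` (\<Union>e\<in>hexagon r. (+) e ` dirs)"
    by (simp add: image_UN image_image add.assoc)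
  then show ?case
    unfolding graph_ball_Suc Suc hexagon_Suc nbhd_TRI image_Un by simp
qed

lemma hexagon_Sigma:
  "hexagon r = (SIGMA x:{- int r..int r}. {max (- int r) (- int r - x)..min (int r) (int r - x)})"
  by (auto simp: hexagon_def)

lemma finite_hexagon: "finite (hexagon r)"
  by (simp add: hexagon_Sigma)

text \<open>\<open>c\<close> must stay fixed while \<open>r\<close> varies in the induction;
  \<open>card_hexagon\<close> then takes \<open>2 * int r + 1\<close>, as the column over
  \<open>x\<close> has \<open>2 * int r + 1 - |x|\<close> points.\<close>

lemma sum_abs_int: "(\<Sum>x\<in>{- int r..int r}. c - \<bar>x\<bar>) = (2 * int r + 1) * c - int r * (int r + 1)"
proof (induction r)
  case (Suc r)
  have "{- int (Suc r)..int (Suc r)} = insert (- int r - 1) (insert (int r + 1) {- int r..int r})"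
    by auto
  then show ?case using Suc by (simp add: algebra_simps)
qed simp

lemma card_hexagon: "card (hexagon r) = 3 * r\<^sup>2 + 3 * r + 1"
proof -
  have "int (card (hexagon r)) = (\<Sum>x\<in>{- int r..int r}.
      int (card {max (- int r) (- int r - x)..min (int r) (int r - x)}))"
    by (simp add: hexagon_Sigma)
  also have "\<dots> = (\<Sum>x\<in>{- int r..int r}. (2 * int r + 1) - \<bar>x\<bar>)"
    by (intro sum.cong) auto
  also have "\<dots> = int (3 * r\<^sup>2 + 3 * r + 1)"
    unfolding sum_abs_int by (simp add: algebra_simps power2_eq_square)
  finally show ?thesis by linarith
qed

lemma finite_graph_ball_TRI: "finite (graph_ball TRI c r)"
  by (simp add: graph_ball_TRI finite_hexagon)

lemma card_graph_ball_TRI: "card (graph_ball TRI c r) = 3 * r\<^sup>2 + 3 * r + 1"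
  by (simp add: graph_ball_TRI card_hexagon card_image)

section \<open>The lower bound on the density\<close>

lemma density_at_TRI_ge:
  assumes S: "RED_LD_set TRI S"
  shows "ereal (1 / 3) \<le> density_at TRI c S"
proof -
  let ?n = "\<lambda>r. real (card (graph_ball TRI c r))"
  \<comment> \<open>For \<open>r\<close> at least 2 this is the size of the ball of radius
    \<open>r - 2\<close> over three times that of radius \<open>r\<close>, with the subtraction done
    in the reals. Quadratic growth makes the loss of radius 2 vanish in the limit.\<close>
  let ?q = "\<lambda>r. (3 * (real r - 2)\<^sup>2 + 3 * (real r - 2) + 1) / (3 * ?n r)"
  have "?q \<longlonglongrightarrow> 1 / 3" unfolding card_graph_ball_TRI by (simp, real_asymp)
  then have "ereal (1 / 3) = limsup (\<lambda>r. ereal (?q r))"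
    by (intro lim_imp_Limsup[symmetric]) auto
  also have "\<dots> \<le> density_at TRI c S"
    unfolding density_at_def
  proof (intro Limsup_mono)
    have "?q r \<le> real (card (graph_ball TRI c r \<inter> S)) / ?n r" if "2 \<le> r" for r
    proof -
      obtain s where s: "r = Suc (Suc s)"
        using \<open>2 \<le> r\<close> by (auto simp: numeral_2_eq_2 dest: le_Suc_ex)
      have "?n s \<le> 3 * real (card (graph_ball TRI c (Suc (Suc s)) \<inter> S))"
        using share_add_share_partner_le_6[OF S] card_detectors_TRI_ge_2[OF S]
        by (intro card_ball_le_card_detectors finite_graph_ball_TRI finite_nbhd_TRI sym_TRI)
          (auto intro: less_le_trans[of 0 "2::nat"])
      moreover have "?n s = 3 * (real r - 2)\<^sup>2 + 3 * (real r - 2) + 1"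
        by (simp add: card_graph_ball_TRI s)
      ultimately have "3 * (real r - 2)\<^sup>2 + 3 * (real r - 2) + 1
          \<le> 3 * real (card (graph_ball TRI c r \<inter> S))"
        by (simp add: s)
      from divide_right_mono[OF this, of "3 * ?n r"] show ?thesis by simp
    qed
    then show "\<forall>\<^sub>F r in sequentially. ereal (?q r)
        \<le> ereal (real (card (graph_ball TRI c r \<inter> S)) / ?n r)"
      by (intro eventually_sequentiallyI[of 2]) simp
  qed
  finally show ?thesis .
qed

section \<open>A periodic set of density one third\<close>

text \<open>An additive map: whether a vertex and its neighbours are detectors depends only on its
  level modulo 6, which reduces the verification to six residues.\<close>

definition level :: "int \<times> int \<Rightarrow> int" where
  "level v = fst v + 2 * snd v"

definition marked :: "int \<Rightarrow> bool" where
  "marked t \<longleftrightarrow> t mod 6 = 0 \<or> t mod 6 = 2"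

definition pattern :: "(int \<times> int) set" where
  "pattern = {v. marked (level v)}"

definition offsets :: "int \<Rightarrow> (int \<times> int) set" where
  "offsets t = Set.filter (\<lambda>d. marked (t + level d)) dirs"

text \<open>A horizontal step raises the level by 1, so the six shifts meet every residue once, and
  two residues are marked.\<close>

lemma card_shifts_in_pattern: "card {i \<in> {0..<6}. p + (i, 0) \<in> pattern} = 2"
proof -
  obtain x y where p: "p = (x, y)" by force
  define t where "t = (x + 2 * y) mod 6"
  have "(x + i + 2 * y) mod 6 = (t + i) mod 6" for i
    unfolding t_def by presburger
  then have eq: "{i \<in> {0..<6}. p + (i, 0) \<in> pattern} = {i \<in> {0..<6}. (t + i) mod 6 \<in> {0, 2}}"
    by (simp add: p pattern_def marked_def level_def)
  have "t \<in> {0, 1, 2, 3, 4, 5}" unfolding t_def by (simp, presburger)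
  then have "{i \<in> {0..<6}. (t + i) mod 6 \<in> {0, 2}} = {(- t) mod 6, (2 - t) mod 6}"
    by (auto; presburger)
  moreover have "(- t) mod 6 \<noteq> (2 - t) mod 6" by presburger
  ultimately show ?thesis unfolding eq by simp
qed

lemma graph_ball_TRI_shift:
  assumes "p \<in> graph_ball TRI c r"
  shows "p - (int i, 0) \<in> graph_ball TRI c (r + i)"
proof -
  obtain e where "e \<in> hexagon r" "p = c + e" using assms by (auto simp: graph_ball_TRI)
  moreover have "e - (int i, 0) \<in> hexagon (r + i)"
    using \<open>e \<in> hexagon r\<close> by (auto simp: hexagon_def)
  ultimately show ?thesis
    unfolding graph_ball_TRI by (intro image_eqI[of _ _ "e - (int i, 0)"]) (simp_all add: algebra_simps)
qed

text \<open>Pairs of a point and a shift into \<open>pattern\<close> are counted twice. Shifting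
  back by \<open>i\<close> embeds the detectors of the ball into the larger ball, whose radius grows
  by the largest shift, 5; each point there has exactly two shifts.\<close>

lemma card_ball_pattern_le:
  "6 * card (graph_ball TRI c r \<inter> pattern) \<le> 2 * card (graph_ball TRI c (r + 5))"
proof -
  let ?B = "graph_ball TRI c r" and ?B' = "graph_ball TRI c (r + 5)"
  have "card (?B \<inter> pattern) \<le> card {p \<in> ?B'. p + (i, 0) \<in> pattern}" if "i \<in> {0..<6}" for i :: int
  proof (rule card_inj_on_le[where f = "\<lambda>p. p - (i, 0)"])
    have "nat i \<le> 5" using \<open>i \<in> {0..<6}\<close> by auto
    then have "p - (i, 0) \<in> ?B'" if "p \<in> ?B" for p
      using graph_ball_TRI_shift[OF that, of "nat i"] graph_ball_mono[of "r + nat i" "r + 5" TRI c]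
        \<open>i \<in> {0..<6}\<close> by auto
    then show "(\<lambda>p. p - (i, 0)) ` (?B \<inter> pattern) \<subseteq> {p \<in> ?B'. p + (i, 0) \<in> pattern}" by auto
  qed (auto simp: inj_on_def finite_graph_ball_TRI)
  then have "(\<Sum>i\<in>{0..<6::int}. card (?B \<inter> pattern))
      \<le> (\<Sum>i\<in>{0..<6}. card {p \<in> ?B'. p + (i, 0) \<in> pattern})"
    by (rule sum_mono)
  also have "\<dots> = (\<Sum>p\<in>?B'. card {i \<in> {0..<6}. p + (i, 0) \<in> pattern})"
    by (rule sum_multicount_gen) (auto simp: finite_graph_ball_TRI)
  also have "\<dots> = 2 * card ?B'"
    by (simp only: card_shifts_in_pattern) simp
  finally show ?thesis by simp
qed

lemma density_at_pattern_le: "density_at TRI c pattern \<le> ereal (1 / 3)"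
proof -
  let ?n = "\<lambda>r. real (card (graph_ball TRI c r))"
  have "(\<lambda>r. ?n (r + 5) / (3 * ?n r)) \<longlonglongrightarrow> 1 / 3"
    unfolding card_graph_ball_TRI by (simp, real_asymp)
  then have "limsup (\<lambda>r. ereal (?n (r + 5) / (3 * ?n r))) = ereal (1 / 3)"
    by (intro lim_imp_Limsup) auto
  moreover have "density_at TRI c pattern \<le> limsup (\<lambda>r. ereal (?n (r + 5) / (3 * ?n r)))"
    unfolding density_at_def
  proof (intro Limsup_mono always_eventually allI)
    fix r
    have "3 * real (card (graph_ball TRI c r \<inter> pattern)) \<le> ?n (r + 5)"
      using card_ball_pattern_le[of c r] by linarith
    from divide_right_mono[OF this, of "3 * ?n r"]
    show "ereal (real (card (graph_ball TRI c r \<inter> pattern)) / ?n r) \<le> ereal (?n (r + 5) / (3 * ?n r))"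
      by simp
  qed
  ultimately show ?thesis by simp
qed

section \<open>The periodic set is a RED:LD set\<close>

lemma level_add: "level (u + v) = level u + level v"
  by (simp add: level_def)

lemma marked_mod: "marked (t mod 6 + s) = marked (t + s)"
  by (simp add: marked_def mod_add_left_eq)

lemma offsets_mod: "offsets (t mod 6 + s) = offsets (t + s)"
  unfolding offsets_def add.assoc marked_mod ..

lemma nbhd_inter_pattern: "nbhd TRI v \<inter> pattern = (+) v ` offsets (level v)"
  by (auto simp: nbhd_TRI offsets_def pattern_def level_add)

text \<open>\<open>w\<close> is the deleted detector relative to the vertex. A marked vertex becomes
  a non-detector only by its own deletion, which leaves its open neighbourhood intact.\<close>

lemma offsets_dominating:
  "\<forall>t\<in>{0, 1, 2, 3, 4, 5}. offsets t \<noteq> {} \<and>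
     (\<forall>w\<in>offsets t. marked t \<or> offsets t - {w} \<noteq> {})"
  by code_simp

text \<open>Vertices with equal nonempty traces share a detector \<open>v + d = u + d'\<close>, so
  only displacements \<open>d - d'\<close> need checking. \<open>B\<close> is the trace of
  \<open>u\<close> seen from \<open>v\<close>. One deletion cannot turn two marked vertices into
  non-detectors; if one is marked, the deleted point \<open>w\<close> must be that vertex. The
  condition \<open>offsets t \<noteq> B\<close> covers deletions outside both traces.\<close>

lemma offsets_separating:
  "\<forall>t\<in>{0, 1, 2, 3, 4, 5}. \<forall>d\<in>offsets t. \<forall>d'\<in>dirs.
     d = d' \<or> marked t \<and> marked (t + level (d - d')) \<or>
     (let B = (+) (d - d') ` offsets (t + level (d - d')) in
       offsets t \<noteq> B \<and>
       (\<forall>w\<in>offsets t \<union> B. (marked t \<longrightarrow> w = 0) \<longrightarrow>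
          (marked (t + level (d - d')) \<longrightarrow> w = d - d') \<longrightarrow> offsets t - {w} \<noteq> B - {w}))"
  by code_simp

lemma LD_pattern: "LD_set TRI (pattern - {w})"
proof -
  have eq: "nbhd TRI p \<inter> (pattern - {w}) = (+) p ` offsets (level p) - {w}" for p
    using nbhd_inter_pattern[of p] by auto
  have ne: "(+) v ` offsets (level v) - {w} \<noteq> {}" if v: "v \<notin> pattern - {w}" for v
  proof
    assume *: "(+) v ` offsets (level v) - {w} = {}"
    define t where "t = level v mod 6"
    have t: "t \<in> {0, 1, 2, 3, 4, 5}" unfolding t_def by (simp, presburger)
    have off: "offsets t = offsets (level v)" "marked t = marked (level v)"
      using offsets_mod[of "level v" 0] marked_mod[of "level v" 0] by (simp_all add: t_def)
    have "offsets t - {w - v} = {}"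
      using * off by auto
    moreover have "offsets t \<noteq> {}" using offsets_dominating t by blast
    ultimately have w: "w - v \<in> offsets t" by blast
    then have "marked t" using offsets_dominating t \<open>offsets t - {w - v} = {}\<close> by blast
    then have "w = v" using v off by (simp add: pattern_def)
    then show False using w by (auto simp: offsets_def dirs_def prod_eq_iff)
  qed
  have "u = v" if u: "u \<notin> pattern - {w}" and v: "v \<notin> pattern - {w}"
    and uv: "(+) v ` offsets (level v) - {w} = (+) u ` offsets (level u) - {w}" for u v
  proof (rule ccontr)
    assume "u \<noteq> v"
    define t where "t = level v mod 6"
    have t: "t \<in> {0, 1, 2, 3, 4, 5}" unfolding t_def by (simp, presburger)
    \<comment> \<open>The traces are equal and, by \<open>ne\<close>, nonempty.\<close>
    obtain z where z: "z \<in> (+) v ` offsets (level v)" "z \<in> (+) u ` offsets (level u)"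
      using ne[OF v] uv by blast
    then obtain d d' where d: "d \<in> offsets (level v)" "z = v + d" "d' \<in> offsets (level u)" "z = u + d'"
      by (elim imageE) 
    define e where "e = d - d'"
    have ue: "u = v + e" using d(2,4) by (simp add: e_def algebra_simps)
    have off: "offsets t = offsets (level v)" "marked t = marked (level v)"
      "offsets (t + level e) = offsets (level u)" "marked (t + level e) = marked (level u)"
      using offsets_mod[of "level v"] marked_mod[of "level v"] offsets_mod[of "level v" 0]
        marked_mod[of "level v" 0]
      by (simp_all add: t_def ue level_add)
    have "d' \<in> dirs" using d(3) by (simp add: offsets_def)
    have "d \<noteq> d'" using \<open>u \<noteq> v\<close> ue by (auto simp: e_def)
    \<comment> \<open>A marked vertex outside \<open>pattern - {w}\<close> is the deleted
      one.\<close>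
    have mv: "marked t \<Longrightarrow> w - v = 0" and mu: "marked (t + level e) \<Longrightarrow> w - v = e"
      using u v off by (auto simp: pattern_def ue)
    define B where "B = (+) e ` offsets (t + level e)"
    have B: "(+) u ` offsets (level u) = (+) v ` B"
      unfolding B_def off(3) ue image_image by (simp add: add.assoc)
    have sep: "offsets t \<noteq> B \<and>
       (\<forall>w\<in>offsets t \<union> B. (marked t \<longrightarrow> w = 0) \<longrightarrow>
          (marked (t + level e) \<longrightarrow> w = e) \<longrightarrow> offsets t - {w} \<noteq> B - {w})"
      using offsets_separating[THEN bspec, OF t, THEN bspec, of d, THEN bspec, OF _ \<open>d' \<in> dirs\<close>]
        d(1) off(1) \<open>d \<noteq> d'\<close> mu mv by (auto simp: Let_def B_def e_def)
    have "(+) v ` (offsets t - {w - v}) = (+) v ` (B - {w - v})"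
      using uv unfolding B off(1)[symmetric] by (simp add: image_set_diff)
    then have eqB: "offsets t - {w - v} = B - {w - v}"
      by (simp add: inj_image_eq_iff)
    \<comment> \<open>The traces differ but agree after the deletion, so the deleted point lies in
      one of them and \<open>sep\<close> applies to it.\<close>
    then have "w - v \<in> offsets t \<union> B" using sep by blast
    then show False using sep eqB mu mv by blast
  qed
  then show ?thesis using ne unfolding LD_set_def eq by metis
qed

lemma RED_LD_pattern: "RED_LD_set TRI pattern"
  \<comment> \<open>\<open>(1, 0)\<close> has level 1, hence is a non-detector.\<close>
  by (rule RED_LD_setI[OF LD_pattern, of "(1, 0)"])
    (simp add: pattern_def marked_def level_def)

theorem theorem19:
  shows "is_RED_LD_percent TRI (1 / 3)"
proof -
  have third: "(1 / 3 :: ereal) = ereal (1 / 3)" by (simp add: one_ereal_def numeral_eq_ereal)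
  have "density_at TRI v pattern = ereal (1 / 3)" for v
    by (rule antisym[OF density_at_pattern_le density_at_TRI_ge[OF RED_LD_pattern]])
  then show ?thesis
    unfolding is_RED_LD_percent_def third using RED_LD_pattern density_at_TRI_ge by blast
qed

end
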